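(* Let $d\ge2$, let $\mathbb S^{d-1}$ be the Euclidean unit sphere, and let $\mathbf X=R\mathbf U$ be a random vector in $\mathbb R^d$ satisfying Assumptions (A1), (A2), (A3) and (A4) listed in the context, where (A4) holds with $S=\overline{T_1}$ (that is, $T_2$ is empty; in particular $S$ does not contain any individual points). For $\mathbf v\in\mathbb S^{d-1}$ let $A_{\mathbf v}$ be the set defined in the context, and let $$\hat S=\bigcap_{\mathbf v\in\mathbb S^{d-1}}A_{\mathbf v}.$$ Then $S=\mathrm{cl}(\hat S)$.
   Context: Setting. The norm is the $l_2$-norm $\|\cdot\|_2$ on $\mathbb R^d$, $\mathbb S^{d-1}=\{\mathbf x\in\mathbb R^d:\|\mathbf x\|_2=1\}$, $R=\|\mathbf X\|_2$, $\mathbf U=\mathbf X/\|\mathbf X\|_2$. The sphere carries the geodesic metric $\mathrm{dist}(\mathbf x,\mathbf y)=\arccos(\mathbf x\cdot\mathbf y)$. $B(\mathbf x,r)=\{\mathbf y\in\mathbb S^{d-1}:\mathrm{dist}(\mathbf x,\mathbf y)<r\}$; open sets, closure $\mathrm{cl}(\cdot)=\overline{\,\cdot\,}$ and Borel sets are with respect to this metric; complements $A^c$ are taken in $\mathbb S^{d-1}$. Convention: $\log 0=-\infty$, so a quotient of $\log 0$ by a negative number is $+\infty$. Definition of $g$ and $G$. Let $k_R=\sup\{k:\mathbb P(R>k)=1\}$. For $k>k_R$ and Borel $A\subset\mathbb S^{d-1}$, $$g(k,A)=\frac{\log \mathbb P(R>k,\mathbf U\in A)}{\log \mathbb P(R>k)}\in[0,\infty],\qquad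 G(A)=\lim_{k\to\infty}g(k,A).$$ Definition of $S$. $S$ is the set of all $\mathbf x\in\mathbb S^{d-1}$ such that for every $\varepsilon>0$: $\mathbb P(\mathbf U\in B(\mathbf x,\varepsilon))>0$ and $\lim_{k\to\infty}\frac{\log \mathbb P(R>k\mid \mathbf U\in B(\mathbf x,\varepsilon))}{\log\mathbb P(R>k)}=1$. Assumptions. (A1) $R$ is a positive random variable with $\mathbb P(R>k)>0$ for all $k\in\mathbb R$, and $\lim_{k\to\infty}-\log(\mathbb P(R>k))/k=0$. (A2) There is a fixed number $k_0>0$ (not depending on $A$) such that for every Borel set $A\subset\mathbb S^{d-1}$ the quantity $\mathbb P(\mathbf U\in A\mid R>k)$ is constant for all $k>k_0$. (In particular the limit distribution of $\mathbf U\mid R>k$ as $k\to\infty$ exists.) (A3) $\lim_{k\to\infty}g(k,A)$ exists in $[0,\infty]$ for every Borel set $A\subset\mathbb S^{d-1}$. (A4) $S^c$ contains a nonempty open set, and $S=\overline{T_1}\cup T_2$, where $T_1$ is a (possibly empty) open subset of $\mathbb S^{d-1}$ and $T_2$ is a (possibly empty) finite set of points of $\mathbb S^{d-1}$, each of which has positive mass under the limit distribution of $\mathbf U\mid R>k$ as $k\to\infty$. Definition of $A_{\mathbf v}$, for $\mathbf v\in\mathbb S^{d-1}$. - If for some $0<r<\pi$ one has $G(B(\mathbf v,r)^c)>1$ and $G(B(\mathbf v,r))=1$, then $A_{\mathbf v}=B(\mathbf v,r_{\mathbf v})$, where $r_{\mathbf v}=\inf\{r>0:G(B(\mathbf v,r)^c)>1\}$.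 - If $G(B(\mathbf v,r)^c)=1$ for all $0<r<\pi$, then $A_{\mathbf v}=\mathbb S^{d-1}$. - If $G(B(\mathbf v,r)^c)>1$ for all $0<r<\pi$, then $A_{\mathbf v}=\emptyset$ (this agrees with the first case, since then $r_{\mathbf v}=0$ and $B(\mathbf v,0)=\emptyset$). *)

theory Defs
  imports "HOL-Probability.Probability"
begin

abbreviation unit_sphere :: "'a::euclidean_space set" where
  "unit_sphere \<equiv> sphere 0 1"

text \<open>
  \<^term>\<open>arccos\<close> is unspecified outside the interval from -1 to 1, while the locale
  \<^locale>\<open>Metric_space\<close> asks for nonnegativity on the whole type; hence the value 0 for points
  off the sphere.
\<close>

definition geo_dist :: "'a::euclidean_space \<Rightarrow> 'a \<Rightarrow> real" where
  "geo_dist x y =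
     (if x \<in> unit_sphere \<and> y \<in> unit_sphere then arccos (x \<bullet> y) else 0)"

lemma abs_inner_unit_sphere:
  fixes x y :: "'a::euclidean_space"
  assumes "x \<in> unit_sphere" "y \<in> unit_sphere"
  shows "\<bar>x \<bullet> y\<bar> \<le> 1"
  using Cauchy_Schwarz_ineq2[of x y] assms by simp

lemma arccos_inner_triangle:
  fixes x y z :: "'a::euclidean_space"
  assumes "x \<in> unit_sphere" "y \<in> unit_sphere" "z \<in> unit_sphere"
  shows "arccos (x \<bullet> z) \<le> arccos (x \<bullet> y) + arccos (y \<bullet> z)"
proof (cases "arccos (x \<bullet> y) + arccos (y \<bullet> z) \<le> pi")
  case True
  define a b where "a = arccos (x \<bullet> y)" and "b = arccos (y \<bullet> z)"
  have bnds: "\<bar>x \<bullet> y\<bar> \<le> 1" "\<bar>y \<bullet> z\<bar> \<le> 1" "\<bar>x \<bullet> z\<bar> \<le> 1"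
    using assms by (auto intro: abs_inner_unit_sphere)
  have n: "x \<bullet> x = 1" "y \<bullet> y = 1" "z \<bullet> z = 1"
    using assms by (simp_all add: dot_square_norm)
  have cs: "cos a = x \<bullet> y" "cos b = y \<bullet> z"
    and sn: "sin a = sqrt (1 - (x \<bullet> y)\<^sup>2)" "sin b = sqrt (1 - (y \<bullet> z)\<^sup>2)"
    using bnds by (auto simp: a_def b_def cos_arccos_abs sin_arccos_abs)
  define u v where "u = x - (x \<bullet> y) *\<^sub>R y" and "v = z - (y \<bullet> z) *\<^sub>R y"
  have nu: "norm u = sin a" and nv: "norm v = sin b"
    unfolding sn norm_eq_sqrt_inner u_def v_def
    by (simp_all add: inner_diff_left inner_diff_right n inner_commute power2_eq_square)
  have "u \<bullet> v = x \<bullet> z - (x \<bullet> y) * (y \<bullet> z)"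
    unfolding u_def v_def
    by (simp add: inner_diff_left inner_diff_right n inner_commute)
  moreover have "\<bar>u \<bullet> v\<bar> \<le> sin a * sin b"
    using Cauchy_Schwarz_ineq2[of u v] by (simp add: nu nv)
  ultimately have "cos (a + b) \<le> x \<bullet> z"
    by (simp add: cos_add cs)
  then have "arccos (x \<bullet> z) \<le> arccos (cos (a + b))"
    using bnds by (intro arccos_le_mono[THEN iffD2]) auto
  also have "arccos (cos (a + b)) = a + b"
    using True bnds by (intro arccos_cos) (auto simp: a_def b_def arccos_lbound abs_le_iff)
  finally show ?thesis by (simp add: a_def b_def)
next
  case False
  have "\<bar>x \<bullet> z\<bar> \<le> 1" using assms by (auto intro: abs_inner_unit_sphere)
  then have "arccos (x \<bullet> z) \<le> pi" by (auto intro: arccos_ubound)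
  with False show ?thesis by simp
qed

interpretation geodesic: Metric_space "unit_sphere :: 'a::euclidean_space set" geo_dist
proof
  fix x y z :: 'a
  show "0 \<le> geo_dist x y"
    using abs_inner_unit_sphere[of x y] by (auto simp: geo_dist_def intro!: arccos_lbound)
  show "geo_dist x y = geo_dist y x"
    by (simp add: geo_dist_def inner_commute)
  show "geo_dist x y = 0 \<longleftrightarrow> x = y" if "x \<in> unit_sphere" "y \<in> unit_sphere"
  proof
    assume "geo_dist x y = 0"
    then have "cos (arccos (x \<bullet> y)) = 1" using that by (simp add: geo_dist_def)
    then have "x \<bullet> y = 1" using abs_inner_unit_sphere[OF that] by (simp add: cos_arccos_abs)
    moreover have "x \<bullet> x = 1" "y \<bullet> y = 1"
      using that by (simp_all add: dot_square_norm)
    ultimately show "x = y"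
      by (metis vector_eq)
  qed (use that in \<open>simp add: geo_dist_def dot_square_norm\<close>)
  show "geo_dist x z \<le> geo_dist x y + geo_dist y z"
    if "x \<in> unit_sphere" "y \<in> unit_sphere" "z \<in> unit_sphere"
    using arccos_inner_triangle[OF that] that by (simp add: geo_dist_def)
qed

definition geo_borel :: "'a::euclidean_space measure" where
  "geo_borel = sigma unit_sphere {V. openin geodesic.mtopology V}"

definition radius :: "('w \<Rightarrow> 'a::euclidean_space) \<Rightarrow> 'w \<Rightarrow> real" where
  "radius X \<omega> = norm (X \<omega>)"

definition direction :: "('w \<Rightarrow> 'a::euclidean_space) \<Rightarrow> 'w \<Rightarrow> 'a" where
  "direction X \<omega> = X \<omega> /\<^sub>R norm (X \<omega>)"

text \<open>Logarithm of a probability, with the convention that the logarithm of 0 is \<open>-\<infinity>\<close>.\<close>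

definition elog :: "real \<Rightarrow> ereal" where
  "elog p = (if p = 0 then -\<infinity> else ereal (ln p))"

text \<open>
  \<open>g M X k A\<close> has its intended meaning only if the denominator is a negative real, i.e. if
  \<open>0 < P(R > k) < 1\<close>. Under the assumptions of the theorem this holds for all large \<open>k\<close>, and only
  the limit as \<open>k\<close> tends to infinity is ever used. A numerator \<open>-\<infinity>\<close> then gives the
  quotient \<open>\<infinity>\<close>.
\<close>

definition g :: "'w measure \<Rightarrow> ('w \<Rightarrow> 'a::euclidean_space) \<Rightarrow> real \<Rightarrow> 'a set \<Rightarrow> ereal" where
  "g M X k A =
     elog (\<P>(\<omega> in M. radius X \<omega> > k \<and> direction X \<omega> \<in> A)) / elog (\<P>(\<omega> in M. radius X \<omega> > k))"

definition G :: "'w measure \<Rightarrow> ('w \<Rightarrow> 'a::euclidean_space) \<Rightarrow> 'a set \<Rightarrow> ereal" where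
  "G M X A = Lim at_top (\<lambda>k. g M X k A)"

definition S_set :: "'w measure \<Rightarrow> ('w \<Rightarrow> 'a::euclidean_space) \<Rightarrow> 'a set" where
  "S_set M X =
     {x \<in> unit_sphere. \<forall>\<epsilon>>0.
        \<P>(\<omega> in M. direction X \<omega> \<in> geodesic.mball x \<epsilon>) > 0 \<and>
        ((\<lambda>k. elog (\<P>(\<omega> in M. radius X \<omega> > k \<bar> direction X \<omega> \<in> geodesic.mball x \<epsilon>))
              / elog (\<P>(\<omega> in M. radius X \<omega> > k))) \<longlongrightarrow> 1) at_top}"

definition A_radius :: "'w measure \<Rightarrow> ('w \<Rightarrow> 'a::euclidean_space) \<Rightarrow> 'a \<Rightarrow> real" where
  "A_radius M X v = Inf {r. 0 < r \<and> G M X (unit_sphere - geodesic.mball v r) > 1}"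

text \<open>
  The definition covers exactly three cases: the first two exclude each other, and on the overlap of
  the first and the third both give the empty set, as the radius is then 0. In any other situation
  the set is left unspecified.
\<close>

definition A_set :: "'w measure \<Rightarrow> ('w \<Rightarrow> 'a::euclidean_space) \<Rightarrow> 'a \<Rightarrow> 'a set" where
  "A_set M X v =
     (if \<exists>r. 0 < r \<and> r < pi \<and> G M X (unit_sphere - geodesic.mball v r) > 1
             \<and> G M X (geodesic.mball v r) = 1
      then geodesic.mball v (A_radius M X v)
      else if \<forall>r. 0 < r \<and> r < pi \<longrightarrow> G M X (unit_sphere - geodesic.mball v r) = 1
      then unit_sphere
      else if \<forall>r. 0 < r \<and> r < pi \<longrightarrow> G M X (unit_sphere - geodesic.mball v r) > 1
      then {}
      else undefined)"

definition S_hat :: "'w measure \<Rightarrow> ('w \<Rightarrow> 'a::euclidean_space) \<Rightarrow> 'a set" where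
  "S_hat M X = (\<Inter>v\<in>unit_sphere. A_set M X v)"

end

theory Submission
  imports Defs
begin

text \<open>
  By (A2), \<open>P(R > k, U \<in> A) = Q(A) P(R > k)\<close> for all large \<open>k\<close>, where \<open>Q\<close> is the limit
  distribution of the direction. Hence \<open>G(A)\<close> is 1 or \<open>\<infinity>\<close> according to whether \<open>Q(A)\<close> is positive
  or zero, and \<open>S\<close> is the support of \<open>Q\<close>. If \<open>x \<notin> S\<close>, a small ball around \<open>x\<close> is null, so
  the antipode \<open>v = -x\<close> has \<open>r\<^sub>v < \<pi>\<close>, and \<open>x \<notin> A\<^sub>v\<close>. If \<open>x\<close> is interior to \<open>S\<close>
  and \<open>-x \<noteq> v\<close>, one may move from \<open>x\<close> a little away from \<open>v\<close> without leaving \<open>S\<close>, so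
  \<open>r\<^sub>v\<close> exceeds the distance from \<open>v\<close> to \<open>x\<close>, and \<open>x \<in> A\<^sub>v\<close>. Therefore
  \<open>T\<^sub>1 \<subseteq> S_hat \<subseteq> S = cl T\<^sub>1\<close>.
\<close>

section \<open>The geodesic metric\<close>

lemma geo_dist_eq_arccos:
  "x \<in> unit_sphere \<Longrightarrow> y \<in> unit_sphere \<Longrightarrow> geo_dist x y = arccos (x \<bullet> y)"
  by (simp add: geo_dist_def)

lemma geo_dist_uminus_left:
  assumes "x \<in> unit_sphere" "y \<in> unit_sphere"
  shows "geo_dist (- x) y = pi - geo_dist x y"
  using assms abs_inner_unit_sphere[OF assms] by (simp add: geo_dist_eq_arccos arccos_minus)

text \<open>Geodesic balls are relatively open because \<open>arccos (x \<bullet> y)\<close> is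
  continuous in \<open>y\<close>. This puts \<open>geo_borel\<close> inside the ambient Borel sets,
  which makes the events about the direction measurable.\<close>

lemma openin_sphere_if_openin_geodesic:
  assumes "openin geodesic.mtopology V"
  shows "openin (top_of_set (unit_sphere :: 'a::euclidean_space set)) V"
proof (subst openin_subopen, intro ballI)
  fix x assume "x \<in> V"
  with assms obtain r where x: "x \<in> unit_sphere" and r: "r > 0" "geodesic.mball x r \<subseteq> V"
    unfolding geodesic.openin_mtopology by blast
  have eq: "geodesic.mball x r = unit_sphere \<inter> (\<lambda>y. arccos (x \<bullet> y)) -` {..<r}"
    using x by (auto simp: geo_dist_def)
  have "continuous_on unit_sphere (\<lambda>y. arccos (x \<bullet> y))"
    using abs_inner_unit_sphere[OF x]
    by (intro continuous_on_arccos continuous_intros) (auto simp: abs_le_iff)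
  then have "openin (top_of_set unit_sphere) (geodesic.mball x r)"
    unfolding eq by (rule continuous_openin_preimage_gen) simp
  with x r show "\<exists>T. openin (top_of_set unit_sphere) T \<and> x \<in> T \<and> T \<subseteq> V"
    by (intro exI[of _ "geodesic.mball x r"]) simp
qed

lemma sets_geo_borel: "sets geo_borel = sigma_sets unit_sphere {V. openin geodesic.mtopology V}"
  unfolding geo_borel_def
  by (rule sets_measure_of) (use openin_subset in fastforce)

lemma sets_geo_borel_subset_borel: "sets (geo_borel :: 'a::euclidean_space measure) \<subseteq> sets borel"
proof
  fix A :: "'a set"
  have sphere: "unit_sphere \<in> sets (borel :: 'a measure)" by simp
  assume "A \<in> sets geo_borel"
  then have "A \<in> sigma_sets unit_sphere {V. openin geodesic.mtopology V}"
    by (simp add: sets_geo_borel)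
  then show "A \<in> sets borel"
  proof induction
    case (Basic V)
    then obtain U where "open U" "V = unit_sphere \<inter> U"
      using openin_sphere_if_openin_geodesic by (auto simp: openin_open)
    then show ?case by simp
  qed (use sphere in auto)
qed

lemma mball_in_geo_borel: "geodesic.mball x r \<in> sets geo_borel"
  by (simp add: sets_geo_borel geodesic.openin_mball sigma_sets.Basic)

lemma compl_mball_in_geo_borel: "unit_sphere - geodesic.mball x r \<in> sets geo_borel"
  using mball_in_geo_borel[of x r] by (auto simp: sets_geo_borel intro: sigma_sets.Compl)

text \<open>Follow the great circle from \<open>v\<close> through \<open>x\<close> for a further arc
  of length \<open>t\<close>. If \<open>v = x\<close> no great circle is singled out, and dimension
  at least 2 supplies one.\<close>

lemma geodesic_extension:
  fixes v x :: "'a::euclidean_space"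
  assumes dim: "DIM('a) \<ge> 2" and v: "v \<in> unit_sphere" and x: "x \<in> unit_sphere"
    and t: "0 \<le> t" "geo_dist v x + t \<le> pi" and less: "geo_dist v x < pi"
  obtains y where "y \<in> unit_sphere" "geo_dist x y = t" "geo_dist v y = geo_dist v x + t"
proof -
  define \<alpha> where "\<alpha> = geo_dist v x"
  have vx: "\<bar>v \<bullet> x\<bar> \<le> 1" using abs_inner_unit_sphere[OF v x] .
  have \<alpha>: "0 \<le> \<alpha>" "\<alpha> < pi" "\<alpha> + t \<le> pi" using less t by (auto simp: \<alpha>_def)
  have cos_\<alpha>: "cos \<alpha> = v \<bullet> x"
    using v x vx by (simp add: \<alpha>_def geo_dist_eq_arccos cos_arccos_abs)
  have n: "x \<bullet> x = 1" "v \<bullet> v = 1" using v x by (simp_all add: dot_square_norm)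
  \<comment> \<open>\<open>u\<close> is a unit tangent vector at \<open>x\<close> pointing away from
    \<open>v\<close>; for \<open>v \<noteq> x\<close> it is the normalised component of
    \<open>- v\<close> orthogonal to \<open>x\<close>.\<close>
  obtain u where u: "u \<bullet> x = 0" "u \<bullet> v = - sin \<alpha>" "u \<bullet> u = 1"
  proof (cases "\<alpha> = 0")
    case True
    then have "v = x" using v x by (simp add: \<alpha>_def)
    obtain w where w: "w \<noteq> 0" "orthogonal x w"
      using orthogonal_to_vector_exists[OF dim, of x] by blast
    show thesis
    proof (rule that[of "w /\<^sub>R norm w"])
      show "(w /\<^sub>R norm w) \<bullet> (w /\<^sub>R norm w) = 1"
        using w by (simp add: dot_square_norm power2_eq_square)
    qed (use w True \<open>v = x\<close> in \<open>auto simp: orthogonal_def inner_commute\<close>)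
  next
    case False
    with \<alpha> have s: "sin \<alpha> > 0" by (intro sin_gt_zero) auto
    have sq: "1 - cos \<alpha> * cos \<alpha> = sin \<alpha> * sin \<alpha>"
      using sin_cos_squared_add[of \<alpha>] by (simp add: power2_eq_square)
    show thesis
    proof (rule that[of "(cos \<alpha> *\<^sub>R x - v) /\<^sub>R sin \<alpha>"])
      show "((cos \<alpha> *\<^sub>R x - v) /\<^sub>R sin \<alpha>) \<bullet> x = 0"
        by (simp add: inner_diff_left n cos_\<alpha>)
      show "((cos \<alpha> *\<^sub>R x - v) /\<^sub>R sin \<alpha>) \<bullet> v = - sin \<alpha>"
        using s sq by (simp add: inner_diff_left n cos_\<alpha>[symmetric] inner_commute[of x v] field_simps)
      show "((cos \<alpha> *\<^sub>R x - v) /\<^sub>R sin \<alpha>) \<bullet> ((cos \<alpha> *\<^sub>R x - v) /\<^sub>R sin \<alpha>) = 1"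
        using s sq
        by (simp add: inner_diff_left inner_diff_right n cos_\<alpha>[symmetric] inner_commute[of x v]
            field_simps)
    qed
  qed
  define y where "y = cos t *\<^sub>R x + sin t *\<^sub>R u"
  have "y \<bullet> y = (cos t)\<^sup>2 + (sin t)\<^sup>2"
    by (simp add: y_def inner_add_left inner_add_right u n inner_commute[of x u] power2_eq_square)
  then have y: "y \<in> unit_sphere" by (simp add: norm_eq_1)
  have "x \<bullet> y = cos t"
    by (simp add: y_def inner_add_right u n inner_commute[of x u])
  moreover have "v \<bullet> y = cos (\<alpha> + t)"
    by (simp add: y_def inner_add_right u inner_commute[of v u] cos_\<alpha>[symmetric] cos_add)
  ultimately show thesis
    using that[OF y] x v y t \<alpha> by (simp add: geo_dist_eq_arccos arccos_cos flip: \<alpha>_def)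
qed

section \<open>Logarithmic ratios\<close>

text \<open>The quotient equals \<open>ln c / ln (p k) + 1\<close> once \<open>p k < 1\<close>, and
  \<open>ln (p k)\<close> tends to minus infinity, so a constant factor disappears on the
  logarithmic scale.\<close>

lemma tendsto_elog_ratio:
  fixes p :: "real \<Rightarrow> real"
  assumes pos: "\<And>k. p k > 0" and lim: "(p \<longlongrightarrow> 0) at_top" and c: "c > 0"
  shows "((\<lambda>k. elog (c * p k) / elog (p k)) \<longlongrightarrow> 1) at_top"
proof -
  have nz: "p k \<noteq> 0" for k using pos[of k] by simp
  have "filterlim p (at_right 0) at_top"
    using lim pos nz by (auto simp: filterlim_at)
  then have ln: "filterlim (\<lambda>k. ln (p k)) at_bot at_top"
    by (rule filterlim_compose[OF ln_at_0])
  then have "((\<lambda>k. ln c / ln (p k) + 1) \<longlongrightarrow> 0 + 1) at_top"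
    by (intro tendsto_add tendsto_const tendsto_divide_0[OF tendsto_const]
        filterlim_at_bot_imp_at_infinity)
  then have "((\<lambda>k. ereal (ln c / ln (p k) + 1)) \<longlongrightarrow> 1) at_top"
    by (simp add: one_ereal_def)
  moreover have "\<forall>\<^sub>F k in at_top. ln (p k) < 0"
    using ln by (auto simp: filterlim_at_bot_dense)
  then have "\<forall>\<^sub>F k in at_top. ereal (ln c / ln (p k) + 1) = elog (c * p k) / elog (p k)"
    by eventually_elim
      (use pos nz c in \<open>auto simp: elog_def ln_mult add_divide_distrib\<close>)
  ultimately show ?thesis by (rule Lim_transform_eventually)
qed

lemma tendsto_elog_zero_ratio:
  fixes p :: "real \<Rightarrow> real"
  assumes pos: "\<And>k. p k > 0" and lim: "(p \<longlongrightarrow> 0) at_top"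
  shows "((\<lambda>k. elog 0 / elog (p k)) \<longlongrightarrow> \<infinity>) at_top"
proof (rule tendsto_eventually)
  have nz: "p k \<noteq> 0" for k using pos[of k] by simp
  have "\<forall>\<^sub>F k in at_top. p k < 1" using lim by (rule order_tendstoD) simp
  then show "\<forall>\<^sub>F k in at_top. elog 0 / elog (p k) = \<infinity>"
    by eventually_elim (use pos nz in \<open>auto simp: elog_def\<close>)
qed

section \<open>The limit distribution of the direction\<close>

locale stable_direction = prob_space M for M :: "'w measure" +
  fixes X :: "'w \<Rightarrow> 'a::euclidean_space" and k0 :: real
  assumes rv [measurable]: "X \<in> borel_measurable M"
    and unbounded: "\<P>(\<omega> in M. radius X \<omega> > k) > 0"
    and k0_pos: "k0 > 0"
    and stable: "A \<in> sets geo_borel \<Longrightarrow>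
      \<exists>c. \<forall>k>k0. \<P>(\<omega> in M. direction X \<omega> \<in> A \<bar> radius X \<omega> > k) = c"
begin

definition tail :: "real \<Rightarrow> real" where
  "tail k = \<P>(\<omega> in M. radius X \<omega> > k)"

text \<open>This is Q. On \<open>geo_borel\<close>, (A2) gives the same value at every level above
  \<open>k0\<close>; \<open>k0 + 1\<close> is one such level.\<close>

definition limit_prob :: "'a set \<Rightarrow> real" where
  "limit_prob A = \<P>(\<omega> in M. direction X \<omega> \<in> A \<bar> radius X \<omega> > k0 + 1)"

lemma measurable_radius [measurable]: "radius X \<in> borel_measurable M"
  unfolding radius_def[abs_def] by measurable

lemma measurable_direction [measurable]: "direction X \<in> borel_measurable M"
  unfolding direction_def[abs_def] by measurable

lemma tail_pos: "tail k > 0"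
  using unbounded by (simp add: tail_def)

lemma tail_tendsto_0: "(tail \<longlongrightarrow> 0) at_top"
proof -
  interpret R: real_distribution "distr M borel (radius X)"
    by (simp add: real_distribution_distr)
  have "tail = (\<lambda>k. 1 - cdf (distr M borel (radius X)) k)"
  proof
    fix k
    have "tail k = prob (space M - {\<omega> \<in> space M. radius X \<omega> \<le> k})"
      unfolding tail_def by (intro arg_cong[where f=prob]) auto
    also have "\<dots> = 1 - prob {\<omega> \<in> space M. radius X \<omega> \<le> k}"
      by (rule prob_compl) measurable
    also have "{\<omega> \<in> space M. radius X \<omega> \<le> k} = radius X -` {..k} \<inter> space M" by auto
    finally show "tail k = 1 - cdf (distr M borel (radius X)) k"
      by (simp add: cdf_def measure_distr)
  qed
  then show ?thesis
    using tendsto_diff[OF tendsto_const[of 1] R.cdf_lim_at_top_prob] by simp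
qed

text \<open>(A2) in product form: beyond \<open>k0\<close> the direction is independent of how far
  the radius exceeds the level.\<close>

lemma prob_joint:
  assumes "A \<in> sets geo_borel" "k > k0"
  shows "\<P>(\<omega> in M. radius X \<omega> > k \<and> direction X \<omega> \<in> A) = limit_prob A * tail k"
proof -
  have "\<P>(\<omega> in M. direction X \<omega> \<in> A \<bar> radius X \<omega> > k) = limit_prob A"
    unfolding limit_prob_def using stable[OF assms(1)] assms(2)
    by (metis less_add_one)
  then show ?thesis
    using tail_pos[of k] by (simp add: cond_prob_def tail_def field_simps conj_commute)
qed

lemma limit_prob_nonneg: "limit_prob A \<ge> 0"
  by (simp add: limit_prob_def cond_prob_def)

lemma event_direction [measurable]:
  assumes "A \<in> sets geo_borel"
  shows "{\<omega> \<in> space M. direction X \<omega> \<in> A} \<in> events"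
proof -
  have "A \<in> sets borel" using assms sets_geo_borel_subset_borel by blast
  then show ?thesis by measurable
qed

lemma limit_prob_mono:
  assumes "A \<subseteq> B" "B \<in> sets geo_borel"
  shows "limit_prob A \<le> limit_prob B"
proof -
  have [measurable]: "B \<in> sets borel" using assms sets_geo_borel_subset_borel by blast
  show ?thesis
    unfolding limit_prob_def cond_prob_def
    using assms(1) by (intro divide_right_mono finite_measure_mono) auto
qed

lemma limit_prob_compl:
  assumes "A \<in> sets geo_borel"
  shows "limit_prob (unit_sphere - A) = 1 - limit_prob A"
proof -
  have [measurable]: "A \<in> sets borel" using assms sets_geo_borel_subset_borel by blast
  have "A \<subseteq> unit_sphere"
    using sets.sets_into_space[OF assms] by (simp add: geo_borel_def space_measure_of_conv)
  let ?E = "\<lambda>A. {\<omega> \<in> space M. direction X \<omega> \<in> A \<and> radius X \<omega> > k0 + 1}"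
  \<comment> \<open>The zero vector has direction 0, off the sphere; a radius above the positive
    level \<open>k0 + 1\<close> excludes it.\<close>
  have "direction X \<omega> \<in> unit_sphere" if "radius X \<omega> > k0 + 1" for \<omega>
  proof -
    have "norm (X \<omega>) \<noteq> 0" using that k0_pos unfolding radius_def by linarith
    then show ?thesis by (simp add: direction_def)
  qed
  then have "{\<omega> \<in> space M. radius X \<omega> > k0 + 1} = ?E A \<union> ?E (unit_sphere - A)" by auto
  moreover have "prob (?E A \<union> ?E (unit_sphere - A)) = prob (?E A) + prob (?E (unit_sphere - A))"
    by (rule finite_measure_Union) auto
  ultimately have "tail (k0 + 1) = prob (?E A) + prob (?E (unit_sphere - A))"
    by (simp add: tail_def)
  then show ?thesis
    using tail_pos[of "k0 + 1"]
    by (simp add: limit_prob_def cond_prob_def tail_def[symmetric] field_simps)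
qed

section \<open>Explicit forms of G, S and the sets A_v\<close>

lemma G_eq:
  assumes "A \<in> sets geo_borel"
  shows "G M X A = (if limit_prob A = 0 then \<infinity> else 1)"
proof -
  have "((\<lambda>k. elog (limit_prob A * tail k) / elog (tail k)) \<longlongrightarrow>
      (if limit_prob A = 0 then \<infinity> else 1)) at_top"
    using tendsto_elog_ratio[OF tail_pos tail_tendsto_0, of "limit_prob A"]
      tendsto_elog_zero_ratio[OF tail_pos tail_tendsto_0] limit_prob_nonneg[of A]
    by (auto simp: less_le)
  moreover have "\<forall>\<^sub>F k in at_top. elog (limit_prob A * tail k) / elog (tail k) = g M X k A"
    using eventually_gt_at_top[of k0]
    by eventually_elim (simp add: g_def prob_joint assms flip: tail_def)
  ultimately have "((\<lambda>k. g M X k A) \<longlongrightarrow> (if limit_prob A = 0 then \<infinity> else 1)) at_top"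
    by (rule Lim_transform_eventually)
  then show ?thesis
    unfolding G_def by (rule tendsto_Lim[OF trivial_limit_at_top_linorder])
qed

lemma S_set_eq:
  "S_set M X = {x \<in> unit_sphere. \<forall>\<epsilon>>0. limit_prob (geodesic.mball x \<epsilon>) > 0}"
proof -
  have "\<P>(\<omega> in M. direction X \<omega> \<in> A) > 0 \<and>
      ((\<lambda>k. elog (\<P>(\<omega> in M. radius X \<omega> > k \<bar> direction X \<omega> \<in> A))
            / elog (\<P>(\<omega> in M. radius X \<omega> > k))) \<longlongrightarrow> 1) at_top
    \<longleftrightarrow> limit_prob A > 0" (is "?m > 0 \<and> (?f \<longlongrightarrow> 1) at_top \<longleftrightarrow> _")
    if A: "A \<in> sets geo_borel" for A
  proof -
    \<comment> \<open>Bayes' rule: conditioning on the direction multiplies the tail by the constant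
      \<open>limit_prob A / ?m\<close>. If \<open>?m = 0\<close>, division by zero makes both sides
      \<open>elog 0 / elog (tail k)\<close>.\<close>
    have ev: "\<forall>\<^sub>F k in at_top. elog (limit_prob A / ?m * tail k) / elog (tail k) = ?f k"
      using eventually_gt_at_top[of k0]
      by eventually_elim (simp add: cond_prob_def prob_joint A flip: tail_def)
    show ?thesis
    proof (cases "limit_prob A = 0")
      case True
      have "(?f \<longlongrightarrow> \<infinity>) at_top"
        using tendsto_elog_zero_ratio[OF tail_pos tail_tendsto_0] ev
        by (simp add: True Lim_transform_eventually)
      then have "\<not> (?f \<longlongrightarrow> 1) at_top"
        using tendsto_unique[of at_top ?f \<infinity> 1] by auto
      with True show ?thesis by simp
    next
      case False
      then have pos: "limit_prob A > 0" using limit_prob_nonneg[of A] by simp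
      \<comment> \<open>Positive limit mass forces positive mass of the direction itself, through
        the joint event at level \<open>k0 + 1\<close>.\<close>
      have "0 < limit_prob A * tail (k0 + 1)" using pos tail_pos by simp
      also have "\<dots> \<le> ?m"
        unfolding prob_joint[OF A less_add_one, symmetric]
        by (intro finite_measure_mono event_direction A) auto
      finally have m: "?m > 0" .
      have "(?f \<longlongrightarrow> 1) at_top"
        using tendsto_elog_ratio[OF tail_pos tail_tendsto_0, of "limit_prob A / ?m"] pos m
        by (intro Lim_transform_eventually[OF _ ev]) simp
      with pos m show ?thesis by simp
    qed
  qed
  from this[OF mball_in_geo_borel] show ?thesis
    unfolding S_set_def by simp
qed

text \<open>\<open>G\<close> takes only the values 1 and \<infinity>, so whenever the first case
  fails the second one holds, and the unspecified value never arises.\<close>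

lemma A_set_eq:
  "A_set M X v =
    (if \<exists>r. 0 < r \<and> r < pi \<and> limit_prob (unit_sphere - geodesic.mball v r) = 0
     then geodesic.mball v
       (Inf {r. 0 < r \<and> limit_prob (unit_sphere - geodesic.mball v r) = 0})
     else unit_sphere)"
proof -
  have G_compl: "G M X (unit_sphere - geodesic.mball v r) > 1 \<longleftrightarrow>
      limit_prob (unit_sphere - geodesic.mball v r) = 0"
    "G M X (unit_sphere - geodesic.mball v r) = 1 \<longleftrightarrow>
      limit_prob (unit_sphere - geodesic.mball v r) \<noteq> 0" for r
    by (simp_all add: G_eq compl_mball_in_geo_borel)
  \<comment> \<open>If the complement of a ball is null, the ball has mass 1 and hence
    \<open>G\<close> is 1 on it.\<close>
  have G_both: "limit_prob (unit_sphere - geodesic.mball v r) = 0 \<and> G M X (geodesic.mball v r) = 1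
      \<longleftrightarrow> limit_prob (unit_sphere - geodesic.mball v r) = 0" for r
    by (auto simp: G_eq mball_in_geo_borel limit_prob_compl)
  show ?thesis
    unfolding A_set_def A_radius_def G_compl G_both by auto
qed

section \<open>Bounds on the intersection of the sets A_v\<close>

lemma S_hat_subset_S_set: "S_hat M X \<subseteq> S_set M X"
proof
  fix x assume x_hat: "x \<in> S_hat M X"
  have sub: "A_set M X v \<subseteq> unit_sphere" for v
    unfolding A_set_eq using geodesic.mball_subset_mspace by auto
  \<comment> \<open>A point of the sphere serves as an index: an intersection over the empty set
    would not confine \<open>x\<close> to the sphere.\<close>
  obtain b :: 'a where "b \<in> Basis" using nonempty_Basis by blast
  then have "b \<in> unit_sphere" by simp
  with x_hat sub have x: "x \<in> unit_sphere" unfolding S_hat_def by blast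
  then have mx: "- x \<in> unit_sphere" by simp
  show "x \<in> S_set M X"
  proof (rule ccontr)
    assume "x \<notin> S_set M X"
    then obtain \<epsilon> where \<epsilon>: "\<epsilon> > 0" "limit_prob (geodesic.mball x \<epsilon>) = 0"
      using x limit_prob_nonneg by (force simp: S_set_eq less_le)
    \<comment> \<open>Halving \<open>min \<epsilon> pi\<close> keeps \<open>r\<close> strictly
      between 0 and \<open>pi\<close> and makes \<open>pi - r < \<epsilon>\<close>. Seen from
      \<open>x\<close>, the complement of the ball of radius \<open>r\<close> about
      \<open>- x\<close> is the closed ball of radius \<open>pi - r\<close>.\<close>
    define r where "r = pi - min \<epsilon> pi / 2"
    have r: "0 < r" "r < pi" "pi - r < \<epsilon>"
      using \<epsilon> pi_gt_zero by (auto simp: r_def min_def)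
    have "unit_sphere - geodesic.mball (- x) r \<subseteq> geodesic.mball x \<epsilon>"
      using x mx r by (auto simp: geo_dist_uminus_left)
    then have null: "limit_prob (unit_sphere - geodesic.mball (- x) r) = 0"
      using limit_prob_mono[OF _ mball_in_geo_borel] \<epsilon> limit_prob_nonneg by (metis order_antisym)
    let ?I = "{r. 0 < r \<and> limit_prob (unit_sphere - geodesic.mball (- x) r) = 0}"
    have "Inf ?I \<le> r"
      using r null by (intro cInf_lower) (auto intro: bdd_belowI[of _ 0])
    have "A_set M X (- x) = geodesic.mball (- x) (Inf ?I)"
      using r null by (auto simp: A_set_eq)
    then have "x \<in> geodesic.mball (- x) (Inf ?I)"
      using x_hat mx unfolding S_hat_def by blast
    moreover have "geo_dist (- x) x = pi"
      using x by (simp add: geo_dist_uminus_left)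
    ultimately have "pi < Inf ?I" by simp
    with \<open>Inf ?I \<le> r\<close> r show False by simp
  qed
qed

lemma open_subset_S_hat:
  assumes dim: "DIM('a) \<ge> 2"
    and T: "openin geodesic.mtopology T" "T \<subseteq> S_set M X"
  shows "T \<subseteq> S_hat M X"
proof
  fix x assume "x \<in> T"
  with T obtain \<delta> where x: "x \<in> unit_sphere" and \<delta>: "\<delta> > 0" "geodesic.mball x \<delta> \<subseteq> T"
    unfolding geodesic.openin_mtopology by blast
  have supp: "limit_prob (geodesic.mball y \<epsilon>) > 0" if "y \<in> S_set M X" "\<epsilon> > 0" for y \<epsilon>
    using that by (simp add: S_set_eq)
  \<comment> \<open>A ball about \<open>v\<close> with null complement comes arbitrarily close to
    every support point \<open>y\<close>: otherwise a ball about \<open>y\<close> of positive mass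
    would lie in the complement.\<close>
  have far: "s \<le> r" if v: "v \<in> unit_sphere" and y: "y \<in> S_set M X" "geo_dist v y = s"
    and null: "limit_prob (unit_sphere - geodesic.mball v r) = 0" for v y r s
  proof (rule ccontr)
    assume "\<not> s \<le> r"
    have "geodesic.mball y (s - r) \<subseteq> unit_sphere - geodesic.mball v r"
    proof
      fix z assume "z \<in> geodesic.mball y (s - r)"
      then show "z \<in> unit_sphere - geodesic.mball v r"
        using geodesic.triangle[of v z y] geodesic.commute[of y z] v y by auto
    qed
    then have "limit_prob (geodesic.mball y (s - r)) \<le> 0"
      using limit_prob_mono[OF _ compl_mball_in_geo_borel] null by metis
    with supp[OF y(1), of "s - r"] \<open>\<not> s \<le> r\<close> show False by simp
  qed
  have "x \<in> A_set M X v" if v: "v \<in> unit_sphere" for v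
  proof (cases "\<exists>r. 0 < r \<and> r < pi \<and> limit_prob (unit_sphere - geodesic.mball v r) = 0")
    case True
    let ?I = "{r. 0 < r \<and> limit_prob (unit_sphere - geodesic.mball v r) = 0}"
    from True obtain r where r: "0 < r" "r < pi"
      "limit_prob (unit_sphere - geodesic.mball v r) = 0" by blast
    \<comment> \<open>This rules out \<open>x = - v\<close>, from which no point is farther from
      \<open>v\<close>.\<close>
    have less: "geo_dist v x < pi"
      using far[OF v _ refl r(3), of x] \<open>x \<in> T\<close> T(2) r by auto
    \<comment> \<open>The bound \<open>\<delta> / 2\<close> keeps the extended point in
      \<open>T\<close>; the other bound stops the arc at the antipode of \<open>v\<close>.\<close>
    define t where "t = min (\<delta> / 2) (pi - geo_dist v x)"
    have t: "0 < t" "t < \<delta>" "geo_dist v x + t \<le> pi"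
      using \<delta> less by (auto simp: t_def)
    obtain y where y: "y \<in> unit_sphere" "geo_dist x y = t" "geo_dist v y = geo_dist v x + t"
      using geodesic_extension[OF dim v x _ t(3) less] t by auto
    then have "y \<in> S_set M X" using \<delta> T x t by auto
    \<comment> \<open>The gain \<open>t > 0\<close> gives the strict inequality that membership of
      \<open>x\<close> in the open ball demands.\<close>
    then have "geo_dist v x + t \<le> Inf ?I"
      using far[OF v _ y(3)] r by (intro cInf_greatest) auto
    with t v x True show ?thesis by (simp add: A_set_eq)
  next
    case False
    show ?thesis unfolding A_set_eq if_not_P[OF False] by (rule x)
  qed
  then show "x \<in> S_hat M X" by (simp add: S_hat_def)
qed

end

theorem theorem4p6:
  fixes M :: "'w measure" and X :: "'w \<Rightarrow> real ^ 'n" and T1 :: "(real ^ 'n) set"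
  assumes dim: "CARD('n) \<ge> 2"
    and prob: "prob_space M"
    and rv: "X \<in> borel_measurable M"
    and A1_pos: "AE \<omega> in M. radius X \<omega> > 0"
    and A1_unbounded: "\<forall>k. \<P>(\<omega> in M. radius X \<omega> > k) > 0"
    and A1_heavy: "((\<lambda>k. - ln (\<P>(\<omega> in M. radius X \<omega> > k)) / k) \<longlongrightarrow> 0) at_top"
    and A2: "\<exists>k0>0. \<forall>A\<in>sets geo_borel. \<exists>c. \<forall>k>k0.
               \<P>(\<omega> in M. direction X \<omega> \<in> A \<bar> radius X \<omega> > k) = c"
    and A3: "\<forall>A\<in>sets geo_borel. \<exists>L\<ge>0. ((\<lambda>k. g M X k A) \<longlongrightarrow> L) at_top"
    and A4_compl: "\<exists>V. openin geodesic.mtopology V \<and> V \<noteq> {} \<and> V \<subseteq> unit_sphere - S_set M X"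
    and A4_open: "openin geodesic.mtopology T1"
    and A4_S: "S_set M X = geodesic.mtopology closure_of T1"
  shows "S_set M X = geodesic.mtopology closure_of (S_hat M X)"
proof -
  from A2 obtain k0 where "k0 > 0" and k0: "\<forall>A\<in>sets geo_borel. \<exists>c. \<forall>k>k0.
      \<P>(\<omega> in M. direction X \<omega> \<in> A \<bar> radius X \<omega> > k) = c"
    by (elim exE conjE)
  interpret prob_space M by (rule prob)
  interpret stable_direction M X k0
  proof
    show "\<P>(\<omega> in M. radius X \<omega> > k) > 0" for k
      by (rule A1_unbounded[rule_format])
    show "\<exists>c. \<forall>k>k0. \<P>(\<omega> in M. direction X \<omega> \<in> A \<bar> radius X \<omega> > k) = c"
      if "A \<in> sets geo_borel" for A
      by (rule k0[rule_format, OF that])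
  qed fact+
  have "T1 \<subseteq> S_set M X"
    unfolding A4_S using openin_subset[OF A4_open] by (rule closure_of_subset)
  then have "T1 \<subseteq> S_hat M X"
    using open_subset_S_hat[OF _ A4_open] dim by simp
  then have "S_set M X \<subseteq> geodesic.mtopology closure_of (S_hat M X)"
    unfolding A4_S by (rule closure_of_mono)
  \<comment> \<open>\<open>S_set M X\<close> is closed, being the closure of
    \<open>T1\<close>.\<close>
  moreover have "geodesic.mtopology closure_of (S_hat M X) \<subseteq> S_set M X"
    using S_hat_subset_S_set by (rule closure_of_minimal) (simp add: A4_S)
  ultimately show ?thesis by simp
qed

end
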